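(* \[\lim_{k\to\infty}\ \lim_{n\to\infty}\sqrt[n]{P(n,k)}=2 .\]
   Context: A permutation of $[n]=\{1,2,\ldots,n\}$ is regarded as a linear ordering (sequence) of the elements of $[n]$. Two permutations of $[n]$ are $k$-neighbor separated if there are two elements of $[n]$ that are neighbors (occupy consecutive positions) in one of the permutations and are separated by exactly $k-2$ other elements in the other permutation (i.e. their positions there differ by exactly $k-1$). $P(n,k)$ denotes the maximal number of pairwise $k$-neighbor separated permutations of $[n]$ (the maximum size of a family in which any two distinct members are $k$-neighbor separated). *)

theory Defs
  imports Complex_Main "HOL-Combinatorics.Multiset_Permutations"
begin

text \<open>
  A permutation of \<open>{1..n}\<close> is a list in \<^term>\<open>permutations_of_set {1..n}\<close>, i.e. a sequence
  in which each element of \<open>{1..n}\<close> occurs exactly once.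
\<close>

definition at_distance :: "nat \<Rightarrow> 'a list \<Rightarrow> 'a \<Rightarrow> 'a \<Rightarrow> bool" where
  "at_distance d xs a b \<longleftrightarrow>
     (\<exists>i j. i < length xs \<and> j < length xs \<and> xs ! i = a \<and> xs ! j = b \<and> (j = i + d \<or> i = j + d))"

text \<open>
  Being separated by exactly \<open>k - 2\<close> other elements means being at distance \<open>k - 1\<close>.
\<close>

definition k_neighbor_separated :: "nat \<Rightarrow> 'a list \<Rightarrow> 'a list \<Rightarrow> bool" where
  "k_neighbor_separated k xs ys \<longleftrightarrow>
     (\<exists>a b. a \<noteq> b \<and>
        (at_distance 1 xs a b \<and> at_distance (k - 1) ys a b \<or>
         at_distance 1 ys a b \<and> at_distance (k - 1) xs a b))"

text \<open>
  The set below is finite and contains 0, so the maximum is attained.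
\<close>

definition P :: "nat \<Rightarrow> nat \<Rightarrow> nat" where
  "P n k = Max {card F | F. F \<subseteq> permutations_of_set {1..n} \<and> pairwise (k_neighbor_separated k) F}"

end

theory Submission
  imports Defs "HOL-Library.FuncSet" "HOL-Real_Asymp.Real_Asymp"
begin

text \<open>
  For fixed \<open>k\<close> the growth rate \<open>L k\<close>, the limit of the \<open>n\<close>-th root of \<open>P n k\<close>, exists by Fekete's
  lemma, since concatenation of permutations makes \<open>P\<close> supermultiplicative in \<open>n\<close>
  (\<open>P_supermultiplicative\<close>, \<open>growth_rate\<close>). It is squeezed between two explicit functions of \<open>k\<close>.

  Upper bound (\<open>P_upper_bound\<close>). Colour the positions with period \<open>k - 1\<close> by
  \<open>0, 1, 0, 1, \<dots>\<close>, the last colour of each period being replaced by \<open>2\<close>. Neighbouring positions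
  have different colours and positions at distance \<open>k - 1\<close> have the same colour. Hence two
  separated permutations colour the elements differently, and \<open>P n k\<close> is at most the number of
  colourings of \<open>n\<close> elements in which only about \<open>n / (k - 1)\<close> elements have colour \<open>2\<close>. That number
  grows like \<open>2 ^ n\<close>, up to an exponential factor whose base tends to \<open>1\<close> with growing \<open>k\<close>.

  Lower bound (\<open>P_lower_bound\<close>). Split the elements into groups of \<open>D = k - 2\<close> and give each group
  a binary word of length \<open>D - 1\<close>. The positions are arranged so that consecutive elements of a
  group have distance \<open>1\<close> or \<open>k - 1\<close> according to the bits of its word; any two different
  assignments of words are then separated. In a grid whose columns are the residue classes
  modulo \<open>D\<close>, a group occupies a staircase that meets every column exactly once, and staircases of
  the same shape stack perfectly. There are only \<open>2 ^ (D - 1)\<close> shapes, so with many groups the wasted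
  space is negligible, and \<open>L k\<close> is at least \<open>2 powr ((D - 1) / D)\<close>.
\<close>

section \<open>Separated families\<close>

lemma finite_family_cards:
  "finite {card F | F. F \<subseteq> permutations_of_set {1..n} \<and> pairwise (k_neighbor_separated k) F}"
proof (rule finite_subset)
  show "{card F | F. F \<subseteq> permutations_of_set {1..n} \<and> pairwise (k_neighbor_separated k) F}
        \<subseteq> card ` Pow (permutations_of_set {1..n})" by auto
qed simp

lemma card_le_P:
  assumes "F \<subseteq> permutations_of_set {1..n}" "pairwise (k_neighbor_separated k) F"
  shows "card F \<le> P n k"
  unfolding P_def using assms by (intro Max_ge finite_family_cards) auto

lemma P_attained:
  obtains F where "F \<subseteq> permutations_of_set {1..n}" "pairwise (k_neighbor_separated k) F"
    "card F = P n k"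
proof -
  let ?S = "{card F | F. F \<subseteq> permutations_of_set {1..n} \<and> pairwise (k_neighbor_separated k) F}"
  have "card ({} :: nat list set) \<in> ?S" by (rule CollectI, rule exI[of _ "{}"]) auto
  then have "Max ?S \<in> ?S" by (intro Max_in finite_family_cards) auto
  then show thesis unfolding P_def[symmetric] using that by auto
qed

lemma P_pos: "1 \<le> P n k"
proof -
  have "card {[1..<Suc n]} \<le> P n k"
    by (rule card_le_P) (auto simp: permutations_of_set_def pairwise_def simp del: upt_Suc)
  then show ?thesis by simp
qed

section \<open>Supermultiplicativity and the growth rate\<close>

lemma at_distance_append1:
  assumes "at_distance d xs a b" shows "at_distance d (xs @ ys) a b"
proof -
  obtain i j where "i < length xs" "j < length xs" "xs ! i = a" "xs ! j = b" "j = i + d \<or> i = j + d"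
    using assms unfolding at_distance_def by blast
  then show ?thesis unfolding at_distance_def
    by (intro exI[of _ i] exI[of _ j]) (auto simp: nth_append)
qed

lemma at_distance_append2: 
  assumes "at_distance d ys a b" shows "at_distance d (xs @ ys) a b"
proof -
  obtain i j where "i < length ys" "j < length ys" "ys ! i = a" "ys ! j = b" "j = i + d \<or> i = j + d"
    using assms unfolding at_distance_def by blast
  then show ?thesis unfolding at_distance_def
    by (intro exI[of _ "length xs + i"] exI[of _ "length xs + j"]) auto
qed

lemma at_distance_map:
  assumes "at_distance d xs a b" shows "at_distance d (map f xs) (f a) (f b)"
proof -
  obtain i j where "i < length xs" "j < length xs" "xs ! i = a" "xs ! j = b" "j = i + d \<or> i = j + d"
    using assms unfolding at_distance_def by blast
  then show ?thesis unfolding at_distance_def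
    by (intro exI[of _ i] exI[of _ j]) auto
qed

text \<open>
  Concatenating a permutation of the first \<open>m\<close> numbers with one of the next \<open>n\<close> keeps all
  distances inside the two pieces, so a pair of elements that separates two first pieces, or two
  second pieces, still separates the concatenations.
\<close>

lemma P_supermultiplicative: "P m k * P n k \<le> P (m + n) k"
proof -
  obtain F where F: "F \<subseteq> permutations_of_set {1..m}" "pairwise (k_neighbor_separated k) F"
    "card F = P m k" by (rule P_attained)
  obtain G where G: "G \<subseteq> permutations_of_set {1..n}" "pairwise (k_neighbor_separated k) G"
    "card G = P n k" by (rule P_attained)
  define glue where "glue = (\<lambda>(xs, ys). xs @ map ((+) m) ys :: nat list)"
  have len: "length xs = m" if "xs \<in> F" for xs
    using F(1) that length_finite_permutations_of_set[of xs "{1..m}"] by auto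
  have inj: "inj_on glue (F \<times> G)"
    by (auto simp: inj_on_def glue_def len)
  have img: "glue ` (F \<times> G) \<subseteq> permutations_of_set {1..m + n}"
  proof clarify
    fix xs ys assume "xs \<in> F" "ys \<in> G"
    then have xs: "set xs = {1..m}" "distinct xs" and ys: "set ys = {1..n}" "distinct ys"
      using F(1) G(1) permutations_of_setD by blast+
    have "(+) m ` {1..n} = {m + 1..m + n}" by (simp add: image_add_atLeastAtMost)
    then show "glue (xs, ys) \<in> permutations_of_set {1..m + n}"
      using xs ys by (auto simp: permutations_of_set_def glue_def distinct_map)
  qed
  have sep: "pairwise (k_neighbor_separated k) (glue ` (F \<times> G))"
  proof (rule pairwiseI)
    fix zs zs' assume "zs \<in> glue ` (F \<times> G)" "zs' \<in> glue ` (F \<times> G)" "zs \<noteq> zs'"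
    then obtain xs ys xs' ys' where z: "zs = xs @ map ((+) m) ys" "zs' = xs' @ map ((+) m) ys'"
      "xs \<in> F" "ys \<in> G" "xs' \<in> F" "ys' \<in> G" "xs \<noteq> xs' \<or> ys \<noteq> ys'"
      by (auto simp: glue_def)
    show "k_neighbor_separated k zs zs'"
    proof (cases "xs = xs'")
      case False
      then have "k_neighbor_separated k xs xs'" using F(2) z by (auto dest: pairwiseD)
      then show ?thesis unfolding z k_neighbor_separated_def
        by (meson at_distance_append1)
    next
      case True
      then have "k_neighbor_separated k ys ys'" using G(2) z by (auto dest: pairwiseD)
      then obtain a b where "a \<noteq> b" "at_distance 1 ys a b \<and> at_distance (k - 1) ys' a b \<or>
         at_distance 1 ys' a b \<and> at_distance (k - 1) ys a b"
        unfolding k_neighbor_separated_def by blast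
      then show ?thesis unfolding z k_neighbor_separated_def
        by (intro exI[of _ "m + a"] exI[of _ "m + b"])
          (auto intro!: at_distance_append2 at_distance_map)
    qed
  qed
  have "P m k * P n k = card (glue ` (F \<times> G))"
    using F(3) G(3) by (simp add: card_image[OF inj] card_cartesian_product)
  also have "\<dots> \<le> P (m + n) k" by (rule card_le_P[OF img sep])
  finally show ?thesis .
qed

text \<open>
  Fekete's lemma, stated with the extra information that the limit is an upper bound for the
  whole sequence: a single good value of \<open>n\<close> then bounds the growth rate of \<open>P n k\<close> from below.
\<close>

lemma superadditive_limit:
  fixes u :: "nat \<Rightarrow> real"
  assumes sup: "\<And>m n. u m + u n \<le> u (m + n)"
    and nonneg: "\<And>n. 0 \<le> u n"
    and bound: "\<And>n. u n \<le> c * real n"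
  obtains l where "(\<lambda>n. u n / real n) \<longlonglongrightarrow> l" "\<And>n. n > 0 \<Longrightarrow> u n / real n \<le> l"
proof
  define X where "X = (\<lambda>n. u n / real n) ` {0<..}"
  define l where "l = Sup X"
  have bdd: "bdd_above X"
    unfolding X_def using bound by (intro bdd_aboveI[of _ c]) (auto simp: field_simps)
  have ne: "X \<noteq> {}" unfolding X_def by auto
  show up: "u n / real n \<le> l" if "n > 0" for n
    unfolding l_def using that bdd by (intro cSup_upper) (auto simp: X_def)
  have mult: "real q * u m \<le> u (q * m)" for q m
  proof (induction q)
    case (Suc q)
    then show ?case using sup[of m "q * m"] by (simp add: algebra_simps)
  qed (use nonneg in simp)
  show "(\<lambda>n. u n / real n) \<longlonglongrightarrow> l"
  proof (rule order_tendstoI)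
    fix a assume "a > l"
    then have "u n / real n < a" if "n > 0" for n using up[OF that] by linarith
    then show "eventually (\<lambda>n. u n / real n < a) sequentially"
      by (intro eventually_mono[OF eventually_gt_at_top[of 0]])
  next
    fix a assume "a < l"
    then obtain m where m: "m > 0" "a < u m / real m"
      unfolding l_def using less_cSup_iff[OF ne bdd] by (auto simp: X_def)
    have "(\<lambda>n. real m / real n) \<longlonglongrightarrow> 0" by (rule lim_const_over_n)
    then have "(\<lambda>n. (1 - real m / real n) * (u m / real m)) \<longlonglongrightarrow> (1 - 0) * (u m / real m)"
      by (intro tendsto_mult tendsto_diff tendsto_const)
    then have "eventually (\<lambda>n. a < (1 - real m / real n) * (u m / real m)) sequentially"
      using m by (intro order_tendstoD(1)) auto
    then show "eventually (\<lambda>n. a < u n / real n) sequentially"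
      using eventually_gt_at_top[of 0]
    proof eventually_elim
      case (elim n)
      let ?q = "n div m"
      have "real n - real m \<le> real (?q * m)"
      proof -
        have "n \<le> ?q * m + m" using m(1) div_mult_mod_eq[of n m] mod_less_divisor[of m n] by linarith
        then have "real n \<le> real (?q * m + m)" by (rule of_nat_mono)
        then show ?thesis by simp
      qed
      then have "(real n - real m) * (u m / real m) \<le> real (?q * m) * (u m / real m)"
        using nonneg[of m] by (intro mult_right_mono) auto
      also have "\<dots> = real ?q * u m" using m(1) by simp
      also have "\<dots> \<le> u (?q * m)" by (rule mult)
      also have "\<dots> \<le> u (?q * m) + u (n mod m)" using nonneg by simp
      also have "\<dots> \<le> u n" using sup[of "?q * m" "n mod m"] by simp
      finally have "(real n - real m) * (u m / real m) / real n \<le> u n / real n"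
        by (intro divide_right_mono) auto
      moreover have "(real n - real m) * (u m / real m) / real n = (1 - real m / real n) * (u m / real m)"
      proof -
        have "1 - real m / real n = (real n - real m) / real n"
          using elim by (simp add: field_simps)
        then show ?thesis by simp
      qed
      ultimately have "(1 - real m / real n) * (u m / real m) \<le> u n / real n" by simp
      with elim show ?case by simp
    qed
  qed
qed

section \<open>The upper bound: a periodic three-colouring of the positions\<close>

text \<open>
  The pattern \<open>0, 1, 0, 1, \<dots>\<close> of period \<open>d\<close> with its last entry replaced by \<open>2\<close>. The third
  colour is what allows an alternating pattern to have odd period; it is used so rarely, once in
  \<open>d\<close> positions, that for large \<open>d\<close> it costs almost nothing.
\<close>

definition colour :: "nat \<Rightarrow> nat \<Rightarrow> nat" where
  "colour d i = (if i mod d = d - 1 then 2 else i mod d mod 2)"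

lemma colour_Suc: "d \<ge> 2 \<Longrightarrow> colour d (Suc i) \<noteq> colour d i"
  unfolding colour_def mod_Suc[of i d] by (auto simp: mod_Suc)

lemma colour_add: "colour d (i + d) = colour d i"
  unfolding colour_def by simp

lemma card_colour_2: "d \<ge> 2 \<Longrightarrow> card {i \<in> {..<n}. colour d i = 2} \<le> n div d"
proof (induction n)
  case (Suc n)
  have iff: "colour d n = 2 \<longleftrightarrow> n mod d = d - 1"
    unfolding colour_def by (auto dest: sym)
  show ?case
  proof (cases "n mod d = d - 1")
    case True
    then have "{i \<in> {..<Suc n}. colour d i = 2} = insert n {i \<in> {..<n}. colour d i = 2}"
      using iff by (auto simp: less_Suc_eq)
    then show ?thesis using Suc True by (simp add: div_Suc mod_Suc)
  next
    case False
    then have "{i \<in> {..<Suc n}. colour d i = 2} = {i \<in> {..<n}. colour d i = 2}"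
      using iff by (auto simp: less_Suc_eq)
    moreover have "n div d \<le> Suc n div d" by (rule div_le_mono) simp
    ultimately show ?thesis using Suc.IH[OF Suc.prems] by (metis order.trans)
  qed
qed simp

text \<open>
  The colouring that a permutation induces on the elements: each element receives the colour of
  its position.
\<close>

definition label_colour :: "nat \<Rightarrow> nat list \<Rightarrow> nat \<Rightarrow> nat" where
  "label_colour d xs = (\<lambda>a\<in>set xs. colour d (inv_into {..<length xs} ((!) xs) a))"

lemma label_colour_nth:
  assumes "distinct xs" "i < length xs"
  shows "label_colour d xs (xs ! i) = colour d i"
  using assms by (simp add: label_colour_def inv_into_f_f inj_on_nth)

text \<open>
  Neighbours have different colours and elements at distance \<open>k - 1\<close> have equal colours, so a
  separating pair is coloured differently by the two permutations.
\<close>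

lemma label_colour_separated:
  assumes k: "k \<ge> 3" and xs: "distinct xs" and ys: "distinct ys"
    and sep: "k_neighbor_separated k xs ys"
  shows "label_colour (k - 1) xs \<noteq> label_colour (k - 1) ys"
proof -
  have nbr: "label_colour (k - 1) zs a \<noteq> label_colour (k - 1) zs b"
    if dist: "at_distance 1 zs a b" and zs: "distinct zs" for zs :: "nat list" and a b
  proof -
    obtain i j where ij: "i < length zs" "j < length zs" "zs ! i = a" "zs ! j = b" "j = Suc i \<or> i = Suc j"
      using dist unfolding at_distance_def by auto
    moreover have "colour (k - 1) (Suc i) \<noteq> colour (k - 1) i" for i
      by (rule colour_Suc) (use k in simp)
    ultimately have "colour (k - 1) i \<noteq> colour (k - 1) j" by metis
    with ij show ?thesis using label_colour_nth[OF zs] by metis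
  qed
  have far: "label_colour (k - 1) zs a = label_colour (k - 1) zs b"
    if dist: "at_distance (k - 1) zs a b" and zs: "distinct zs" for zs :: "nat list" and a b
  proof -
    obtain i j where ij: "i < length zs" "j < length zs" "zs ! i = a" "zs ! j = b"
      "j = i + (k - 1) \<or> i = j + (k - 1)"
      using dist unfolding at_distance_def by auto
    then have "colour (k - 1) i = colour (k - 1) j"
      using colour_add[of "k - 1"] by metis
    then show ?thesis using ij label_colour_nth[OF zs] by metis
  qed
  show ?thesis
    using sep nbr far xs ys unfolding k_neighbor_separated_def by metis
qed

text \<open>
  Weight each colouring by \<open>x\<close> to the number of elements of colour \<open>2\<close>. The total weight
  factorises over the elements, while every colouring counted here weighs at least \<open>x ^ m\<close>.
\<close>

lemma card_few_twos:
  fixes x :: real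
  assumes "finite A" "0 < x" "x \<le> 1"
  shows "real (card {c \<in> A \<rightarrow>\<^sub>E {0, 1, 2 :: nat}. card {a \<in> A. c a = 2} \<le> m}) * x ^ m \<le> (2 + x) ^ card A"
proof -
  let ?E = "A \<rightarrow>\<^sub>E {0, 1, 2 :: nat}"
  let ?C = "{c \<in> ?E. card {a \<in> A. c a = 2} \<le> m}"
  let ?w = "\<lambda>v :: nat. if v = 2 then x else 1"
  have fin: "finite ?E" using assms(1) by (intro finite_PiE) auto
  have w: "(\<Prod>a\<in>A. ?w (c a)) = x ^ card {a \<in> A. c a = 2}" for c
    using assms(1) by (subst prod.If_cases) (auto simp: Int_def)
  have "real (card ?C) * x ^ m = (\<Sum>c\<in>?C. x ^ m)" by simp
  also have "\<dots> \<le> (\<Sum>c\<in>?C. x ^ card {a \<in> A. c a = 2})"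
    using assms by (intro sum_mono power_decreasing) auto
  also have "\<dots> \<le> (\<Sum>c\<in>?E. x ^ card {a \<in> A. c a = 2})"
    using assms fin by (intro sum_mono2) auto
  also have "\<dots> = (\<Sum>c\<in>?E. \<Prod>a\<in>A. ?w (c a))" by (simp only: w)
  also have "\<dots> = (\<Prod>a\<in>A. \<Sum>v\<in>{0, 1, 2}. ?w v)"
    using assms(1) by (intro prod_sum_PiE[symmetric]) auto
  also have "\<dots> = (2 + x) ^ card A" by (simp add: add.commute)
  finally show ?thesis .
qed

text \<open>
  The induced colouring is injective on a separated family. The weight \<open>x = 1 / d\<close> used in the
  counting makes both factors of the bound tend to their limits, \<open>2\<close> and \<open>1\<close>, as \<open>d\<close> grows.
\<close>

lemma P_upper_bound:
  assumes k: "k \<ge> 3"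
  defines "d \<equiv> real (k - 1)"
  shows "real (P n k) \<le> ((2 + 1 / d) * d powr (1 / d)) ^ n"
proof -
  obtain F where F: "F \<subseteq> permutations_of_set {1..n}" "pairwise (k_neighbor_separated k) F"
    "card F = P n k" by (rule P_attained)
  have perm: "distinct xs" "set xs = {1..n}" "length xs = n" if "xs \<in> F" for xs
    using F(1) that length_finite_permutations_of_set[of xs "{1..n}"]
    by (auto simp: permutations_of_set_def)
  have d: "d \<ge> 2" using k by (simp add: d_def)
  let ?q = "n div (k - 1)"
  let ?C = "{c \<in> {1..n} \<rightarrow>\<^sub>E {0, 1, 2 :: nat}. card {a \<in> {1..n}. c a = 2} \<le> ?q}"
  have inj: "inj_on (label_colour (k - 1)) F"
  proof (rule inj_onI, rule ccontr)
    fix xs ys assume "xs \<in> F" "ys \<in> F" "label_colour (k - 1) xs = label_colour (k - 1) ys" "xs \<noteq> ys"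
    then show False
      using label_colour_separated[OF k, of xs ys] perm pairwiseD[OF F(2)] by blast
  qed
  have "label_colour (k - 1) ` F \<subseteq> ?C"
  proof clarify
    fix xs assume xs: "xs \<in> F"
    have "label_colour (k - 1) xs \<in> {1..n} \<rightarrow>\<^sub>E {0, 1, 2}"
      unfolding label_colour_def perm(2)[OF xs] by (auto simp: colour_def)
    moreover have "{a \<in> {1..n}. label_colour (k - 1) xs a = 2} = (!) xs ` {i \<in> {..<n}. colour (k - 1) i = 2}"
    proof -
      have "{1..n} = (!) xs ` {..<n}"
        using perm[OF xs] by (metis atLeast0LessThan map_nth set_map set_upt)
      then show ?thesis using perm[OF xs] label_colour_nth[of xs] by auto
    qed
    then have "card {a \<in> {1..n}. label_colour (k - 1) xs a = 2} \<le> card {i \<in> {..<n}. colour (k - 1) i = 2}"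
      by (simp add: card_image_le)
    then have "card {a \<in> {1..n}. label_colour (k - 1) xs a = 2} \<le> ?q"
      using card_colour_2[of "k - 1" n] k by linarith
    ultimately show "label_colour (k - 1) xs \<in> {1..n} \<rightarrow>\<^sub>E {0, 1, 2} \<and>
      card {a \<in> {1..n}. label_colour (k - 1) xs a = 2} \<le> ?q" by blast
  qed
  then have "card F \<le> card ?C"
    using card_mono[of ?C "label_colour (k - 1) ` F"] card_image[OF inj]
    by (simp add: finite_PiE)
  then have "real (P n k) * (1 / d) ^ ?q \<le> real (card ?C) * (1 / d) ^ ?q"
    using F(3) d by (intro mult_right_mono) auto
  also have "\<dots> \<le> (2 + 1 / d) ^ n"
    using card_few_twos[of "{1..n}" "1 / d" ?q] d by simp
  finally have "real (P n k) \<le> (2 + 1 / d) ^ n * d ^ ?q"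
    using d by (simp add: field_simps)
  moreover have "d ^ ?q \<le> (d powr (1 / d)) ^ n"
  proof -
    have "real ?q \<le> real n / d" unfolding d_def by (rule of_nat_div_le_of_nat)
    then have "d powr real ?q \<le> d powr (real n / d)" using d by (intro powr_mono) auto
    also have "\<dots> = (d powr (1 / d)) ^ n" using d by (simp add: powr_power)
    finally show ?thesis using d by (simp add: powr_realpow)
  qed
  ultimately have "real (P n k) \<le> (2 + 1 / d) ^ n * (d powr (1 / d)) ^ n"
    using d by (elim order.trans) (intro mult_left_mono, auto)
  then show ?thesis by (simp add: power_mult_distrib)
qed

section \<open>The lower bound: stacking staircases\<close>

lemma ex_permutation_with_positions:
  assumes L: "L \<subseteq> {1..n}" and inj: "inj_on p L" and range: "p ` L \<subseteq> {..<n}"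
  obtains xs where "xs \<in> permutations_of_set {1..n}" "\<And>a. a \<in> L \<Longrightarrow> xs ! p a = a"
proof -
  have fin: "finite L" using L finite_subset by blast
  have "card ({1..n} - L) = card ({..<n} - p ` L)"
    using L inj range fin by (simp add: card_Diff_subset card_image)
  then obtain h where h: "bij_betw h ({1..n} - L) ({..<n} - p ` L)"
    using finite_same_card_bij[of "{1..n} - L" "{..<n} - p ` L"] by auto
  define q where "q a = (if a \<in> L then p a else h a)" for a
  have "bij_betw q L (p ` L)"
    using inj by (auto simp: bij_betw_def q_def inj_on_def)
  moreover have "bij_betw q ({1..n} - L) ({..<n} - p ` L)"
    using h by (rule bij_betw_cong[THEN iffD1, rotated]) (simp add: q_def)
  ultimately have "bij_betw q (L \<union> ({1..n} - L)) (p ` L \<union> ({..<n} - p ` L))"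
    by (rule bij_betw_combine) auto
  then have q: "bij_betw q {1..n} {..<n}"
    using L range by (simp add: Un_absorb1)
  let ?r = "inv_into {1..n} q"
  have r: "bij_betw ?r {..<n} {1..n}" using q by (rule bij_betw_inv_into)
  show thesis
  proof
    show "map ?r [0..<n] \<in> permutations_of_set {1..n}"
      using r by (auto simp: permutations_of_set_def distinct_map bij_betw_def atLeast0LessThan)
    fix a assume a: "a \<in> L"
    then have "q a = p a" "p a < n" "a \<in> {1..n}" using L range by (auto simp: q_def)
    then show "map ?r [0..<n] ! p a = a"
      using bij_betw_inv_into_left[OF q, of a] by simp
  qed
qed

lemma ex_sorting_rank:
  fixes f :: "nat \<Rightarrow> nat"
  obtains \<rho> where "inj_on \<rho> {..<G}" "\<And>g. g < G \<Longrightarrow> \<rho> g < G"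
    "\<And>g h. g < G \<Longrightarrow> h < G \<Longrightarrow> \<rho> g < \<rho> h \<Longrightarrow> f g \<le> f h"
proof -
  define xs where "xs = sort_key f [0..<G]"
  have len: "length xs = G" by (simp add: xs_def)
  have "bij_betw ((!) xs) {..<G} {..<G}"
    by (rule bij_betw_nth) (auto simp: xs_def)
  then have b: "bij_betw (inv_into {..<G} ((!) xs)) {..<G} {..<G}"
    and inv: "\<And>g. g < G \<Longrightarrow> xs ! inv_into {..<G} ((!) xs) g = g"
    by (auto simp: bij_betw_inv_into bij_betw_inv_into_right)
  have sorted: "sorted (map f xs)" by (simp add: xs_def)
  show thesis
  proof
    show "inj_on (inv_into {..<G} ((!) xs)) {..<G}" using b by (simp add: bij_betw_def)
    show lt: "inv_into {..<G} ((!) xs) g < G" if "g < G" for g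
      using bij_betwE[OF b] that by auto
    show "f g \<le> f h" if "g < G" "h < G" "inv_into {..<G} ((!) xs) g < inv_into {..<G} ((!) xs) h" for g h
      using sorted_nth_mono[OF sorted, of "inv_into {..<G} ((!) xs) g" "inv_into {..<G} ((!) xs) h"]
        that lt len inv by simp
  qed
qed

text \<open>
  A binary word \<open>w\<close> is read as a staircase: its cell \<open>t\<close> lies in column \<open>t\<close>, and the step from
  column \<open>t\<close> to column \<open>t + 1\<close> climbs one row precisely when bit \<open>t\<close> is set.
\<close>

definition height :: "nat \<Rightarrow> nat \<Rightarrow> nat" where
  "height w t = (\<Sum>s<t. of_bool (bit w s))"

lemma height_le: "height w t \<le> t"
  unfolding height_def by (rule order.trans[OF sum_bounded_above[where K = 1]]) auto

lemma height_Suc: "height w (Suc t) = height w t + of_bool (bit w t)"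
  unfolding height_def by simp

text \<open>
  Place position \<open>D * y + x\<close> with \<open>x < D\<close> at column \<open>x\<close> and row \<open>y\<close> of a grid of width \<open>D\<close>, so
  that \<open>k - 1 = D + 1\<close> is a diagonal step, one column to the right and one row up. Group \<open>g\<close>
  consists of \<open>D\<close> elements and is laid along the staircase of a word \<open>f g\<close> with \<open>D - 1\<close> bits;
  consecutive elements of a group are then neighbours or at distance \<open>k - 1\<close>, as the corresponding
  bit says, so two different choices of \<open>f\<close> are separated at any differing bit.

  Staircases of equal shape stack without gaps. Sorting the groups by their words therefore puts
  them into the grid with gaps only where the word changes; shifting by \<open>D\<close> rows per unit of the
  word is enough there, because a staircase climbs fewer than \<open>D\<close> rows. Altogether
  \<open>G + D * 2 ^ (D - 1)\<close> rows suffice, where the second summand does not depend on \<open>G\<close>.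
\<close>

lemma P_lower_bound:
  assumes D: "D \<ge> 1"
  shows "2 ^ ((D - 1) * G) \<le> P (D * (G + D * 2 ^ (D - 1))) (D + 2)"
proof -
  define T where "T = (2 :: nat) ^ (D - 1)"
  define n where "n = D * (G + D * T)"
  define M where "M = {..<G} \<rightarrow>\<^sub>E {..<T}"
  define lab where "lab g t = Suc (D * g + t)" for g t
  have block: "D * x + D \<le> D * y" if "x < y" for x y
  proof -
    have "D * x + D = D * Suc x" by simp
    also have "\<dots> \<le> D * y" by (rule mult_le_mono2) (use that in simp)
    finally show ?thesis .
  qed
  have lab_le: "lab g t \<le> D * G" if "g < G" "t < D" for g t
    unfolding lab_def using block[OF that(1)] that(2) by linarith
  have "\<exists>xs \<rho>. xs \<in> permutations_of_set {1..n} \<and>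
      (\<forall>g<G. \<forall>t<D. D * (\<rho> g + D * f g + height (f g) t) + t < n \<and>
         xs ! (D * (\<rho> g + D * f g + height (f g) t) + t) = lab g t)" if f: "f \<in> M" for f
  proof -
    obtain \<rho> where \<rho>: "inj_on \<rho> {..<G}" "\<And>g. g < G \<Longrightarrow> \<rho> g < G"
      "\<And>g h. g < G \<Longrightarrow> h < G \<Longrightarrow> \<rho> g < \<rho> h \<Longrightarrow> f g \<le> f h"
      using ex_sorting_rank[of G f] by blast
    define row where "row g t = \<rho> g + D * f g + height (f g) t" for g t
    have mono: "row g t < row h t" if "g < G" "h < G" "t < D" "\<rho> g < \<rho> h" for g h t
    proof (cases "f g = f h")
      case False
      then have "f g < f h" using \<rho>(3)[OF that(1,2,4)] by simp
      from block[OF this] show ?thesis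
        unfolding row_def using height_le[of "f g" t] that(3,4) by linarith
    qed (use that in \<open>simp add: row_def\<close>)
    have row_inj: "g = h" if "g < G" "h < G" "t < D" "row g t = row h t" for g h t
    proof (rule ccontr)
      assume "g \<noteq> h"
      then have "\<rho> g \<noteq> \<rho> h" using \<rho>(1) that by (auto simp: inj_on_def)
      then show False using mono[of g h t] mono[of h g t] that by (auto simp: neq_iff)
    qed
    have row_lt: "row g t < G + D * T" if "g < G" "t < D" for g t
    proof -
      have "f g < T" using PiE_mem[OF f[unfolded M_def], of g] that by simp
      from block[OF this] show ?thesis
        unfolding row_def using height_le[of "f g" t] \<rho>(2)[OF that(1)] that(2) by linarith
    qed
    \<comment> \<open>the position of element \<open>a\<close>, i.e. of cell \<open>(a - 1) mod D\<close> of group \<open>(a - 1) div D\<close>; the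
      elements above \<open>D * G\<close> belong to no group and fill the remaining positions arbitrarily\<close>
    define p where "p a = D * row ((a - 1) div D) ((a - 1) mod D) + (a - 1) mod D" for a
    have p_lab: "p (lab g t) = D * row g t + t" if "t < D" for g t
      using that by (simp add: p_def lab_def)
    have lt: "D * row g t + t < n" if "g < G" "t < D" for g t
      unfolding n_def using block[OF row_lt[OF that]] that(2) by linarith
    have split: "\<exists>g t. g < G \<and> t < D \<and> a = lab g t" if "a \<in> {1..D * G}" for a
    proof -
      have "(a - 1) div D < G" using that D by (intro less_mult_imp_div_less) (auto simp: mult.commute)
      moreover have "(a - 1) mod D < D" using D by simp
      moreover have "a = lab ((a - 1) div D) ((a - 1) mod D)" using that by (simp add: lab_def)
      ultimately show ?thesis by blast
    qed
    have "inj_on p {1..D * G}"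
    proof (rule inj_onI)
      fix a b assume ab: "a \<in> {1..D * G}" "b \<in> {1..D * G}" and eq: "p a = p b"
      from split[OF ab(1)] obtain g t where a: "g < G" "t < D" "a = lab g t" by blast
      from split[OF ab(2)] obtain h s where b: "h < G" "s < D" "b = lab h s" by blast
      have eq': "D * row g t + t = D * row h s + s" using eq a b p_lab by simp
      have "t = (D * row g t + t) mod D" using a by simp
      also have "\<dots> = s" using eq' b by simp
      finally have ts: "t = s" .
      with eq' D have "row g t = row h t" by simp
      then have "g = h" by (rule row_inj[OF a(1) b(1) a(2)])
      with ts a b show "a = b" by simp
    qed
    moreover have "p ` {1..D * G} \<subseteq> {..<n}"
    proof (rule image_subsetI)
      fix a assume "a \<in> {1..D * G}"
      from split[OF this] obtain g t where "g < G" "t < D" "a = lab g t" by blast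
      then show "p a \<in> {..<n}" using lt p_lab by simp
    qed
    moreover have "D * G \<le> n" unfolding n_def by (rule mult_le_mono2) simp
    then have "{1..D * G} \<subseteq> {1..n}" by auto
    ultimately obtain xs where xs: "xs \<in> permutations_of_set {1..n}" "\<And>a. a \<in> {1..D * G} \<Longrightarrow> xs ! p a = a"
      using ex_permutation_with_positions[of "{1..D * G}" n p] by blast
    have "xs ! (D * row g t + t) = lab g t" if "g < G" "t < D" for g t
      using xs(2)[of "lab g t"] lab_le[OF that] p_lab that by (simp add: lab_def)
    then show ?thesis using xs(1) lt unfolding row_def by blast
  qed
  then obtain perm \<rho> where perm: "\<And>f. f \<in> M \<Longrightarrow> perm f \<in> permutations_of_set {1..n}"
    and place: "\<And>f g t. f \<in> M \<Longrightarrow> g < G \<Longrightarrow> t < D \<Longrightarrow>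
      D * (\<rho> f g + D * f g + height (f g) t) + t < n \<and>
      perm f ! (D * (\<rho> f g + D * f g + height (f g) t) + t) = lab g t"
    by metis
  have len: "length (perm f) = n" if "f \<in> M" for f
    using length_finite_permutations_of_set[OF perm[OF that]] by simp
  have step: "at_distance (if bit (f g) t then D + 1 else 1) (perm f) (lab g t) (lab g (Suc t))"
    if f: "f \<in> M" and g: "g < G" and t: "Suc t < D" for f g t
    unfolding at_distance_def
  proof (intro exI conjI disjI1)
    let ?i = "\<lambda>t. D * (\<rho> f g + D * f g + height (f g) t) + t"
    show "?i t < length (perm f)" "?i (Suc t) < length (perm f)"
      "perm f ! ?i t = lab g t" "perm f ! ?i (Suc t) = lab g (Suc t)"
      using place[OF f g, of t] place[OF f g, of "Suc t"] t len[OF f] by auto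
    show "?i (Suc t) = ?i t + (if bit (f g) t then D + 1 else 1)"
      by (simp add: height_Suc algebra_simps)
  qed
  have sep: "k_neighbor_separated (D + 2) (perm f) (perm f')"
    and neq: "perm f \<noteq> perm f'" if f: "f \<in> M" and f': "f' \<in> M" and "f \<noteq> f'" for f f'
  proof -
    obtain g where g: "g < G" "f g \<noteq> f' g"
      using PiE_ext[OF f[unfolded M_def] f'[unfolded M_def]] \<open>f \<noteq> f'\<close> by blast
    have high: "\<not> bit w s" if "w < T" "s \<ge> D - 1" for w s
    proof -
      have "take_bit (D - 1) w = w" using that by (simp add: T_def take_bit_nat_eq_self)
      then show ?thesis using that by (metis bit_take_bit_iff not_less)
    qed
    obtain t where t: "bit (f g) t \<noteq> bit (f' g) t" using g(2) by (auto simp: bit_eq_iff)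
    have "f g < T" "f' g < T"
      using PiE_mem[OF f[unfolded M_def], of g] PiE_mem[OF f'[unfolded M_def], of g] g(1) by auto
    then have "\<not> t \<ge> D - 1" using high t by blast
    then have "Suc t < D" by linarith
    then have d: "at_distance (if bit (f g) t then D + 1 else 1) (perm f) (lab g t) (lab g (Suc t))"
      "at_distance (if bit (f' g) t then D + 1 else 1) (perm f') (lab g t) (lab g (Suc t))"
      using step f f' g(1) by auto
    have "lab g t \<noteq> lab g (Suc t)" by (simp add: lab_def)
    then show sep: "k_neighbor_separated (D + 2) (perm f) (perm f')"
      unfolding k_neighbor_separated_def using d t
      by (intro exI[of _ "lab g t"] exI[of _ "lab g (Suc t)"]) (auto split: if_splits)
    show "perm f \<noteq> perm f'"
      using label_colour_separated[OF _ _ _ sep] permutations_of_setD(2)[OF perm[OF f]]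
        permutations_of_setD(2)[OF perm[OF f']] D by auto
  qed
  have "inj_on perm M" using neq by (meson inj_onI)
  then have "card (perm ` M) = T ^ G" by (simp add: card_image M_def card_PiE)
  moreover have "card (perm ` M) \<le> P n (D + 2)"
    using perm sep by (intro card_le_P) (auto simp: pairwise_def)
  ultimately show ?thesis by (simp add: T_def n_def power_mult)
qed

section \<open>The limit\<close>

lemma root_eq_exp: "n > 0 \<Longrightarrow> x > 0 \<Longrightarrow> root n x = exp (ln x / real n)"
  by (simp add: root_powr_inverse powr_def)

lemma growth_rate:
  assumes k: "k \<ge> 3"
  obtains L where "(\<lambda>n. root n (real (P n k))) \<longlonglongrightarrow> L"
    "\<And>n. n > 0 \<Longrightarrow> root n (real (P n k)) \<le> L"
proof -
  define d where "d = real (k - 1)"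
  define C where "C = (2 + 1 / d) * d powr (1 / d)"
  define u where "u n = ln (real (P n k))" for n
  have C: "C > 0" using k by (simp add: C_def d_def add_pos_nonneg)
  have pos: "real (P n k) \<ge> 1" for n using P_pos[of n k] by linarith
  have "u m + u n \<le> u (m + n)" for m n
  proof -
    have "u m + u n = ln (real (P m k * P n k))"
      using pos[of m] pos[of n] by (simp add: u_def ln_mult)
    also have "\<dots> \<le> u (m + n)"
      unfolding u_def
    proof (rule ln_mono)
      show "real (P m k * P n k) > 0" using P_pos[of m k] P_pos[of n k] by simp
      show "real (P m k * P n k) \<le> real (P (m + n) k)"
        by (rule of_nat_mono) (rule P_supermultiplicative)
    qed
    finally show ?thesis .
  qed
  moreover have "0 \<le> u n" for n using pos[of n] by (simp add: u_def)
  moreover have "u n \<le> ln C * real n" for n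
  proof -
    have "u n \<le> ln (C ^ n)"
      unfolding u_def
    proof (rule ln_mono)
      show "real (P n k) > 0" using pos[of n] by linarith
      show "real (P n k) \<le> C ^ n" unfolding C_def d_def by (rule P_upper_bound[OF k])
    qed
    then show ?thesis using C by (simp add: ln_realpow mult.commute)
  qed
  ultimately obtain l where l: "(\<lambda>n. u n / real n) \<longlonglongrightarrow> l" "\<And>n. n > 0 \<Longrightarrow> u n / real n \<le> l"
    using superadditive_limit[of u "ln C"] by blast
  have root: "root n (real (P n k)) = exp (u n / real n)" if "n > 0" for n
    unfolding u_def using that pos[of n] by (intro root_eq_exp) auto
  show thesis
  proof
    have "(\<lambda>n. exp (u n / real n)) \<longlonglongrightarrow> exp l" by (intro tendsto_exp l)
    then show "(\<lambda>n. root n (real (P n k))) \<longlonglongrightarrow> exp l"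
      by (rule Lim_transform_eventually)
        (intro eventually_mono[OF eventually_gt_at_top[of 0]], simp add: root)
    show "root n (real (P n k)) \<le> exp l" if "n > 0" for n
      using l(2)[OF that] root[OF that] by simp
  qed
qed

text \<open>
  For the lower estimate, the positions lost to gaps between staircases become negligible as the
  number \<open>G\<close> of groups grows while \<open>k\<close> stays fixed. What remains lost is the one element in
  \<open>k - 2\<close> at which a group starts.
\<close>

lemma growth_rate_bounds:
  assumes k: "k \<ge> 3" and L: "(\<lambda>n. root n (real (P n k))) \<longlonglongrightarrow> L"
  shows "2 powr (real (k - 3) / real (k - 2)) \<le> L"
    and "L \<le> (2 + 1 / real (k - 1)) * real (k - 1) powr (1 / real (k - 1))"
proof -
  let ?C = "(2 + 1 / real (k - 1)) * real (k - 1) powr (1 / real (k - 1))"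
  show "L \<le> ?C"
  proof (rule tendsto_upperbound[OF L])
    have "root n (real (P n k)) \<le> ?C" if "n > 0" for n
    proof -
      have "root n (real (P n k)) \<le> root n (?C ^ n)"
        using P_upper_bound[OF k, of n] that by (intro real_root_le_mono) auto
      also have "\<dots> = ?C" using that by (intro real_root_power_cancel) auto
      finally show ?thesis .
    qed
    then show "\<forall>\<^sub>F n in sequentially. root n (real (P n k)) \<le> ?C"
      by (intro eventually_mono[OF eventually_gt_at_top[of 0]])
  qed simp
  obtain L' where L': "(\<lambda>n. root n (real (P n k))) \<longlonglongrightarrow> L'"
    "\<And>n. n > 0 \<Longrightarrow> root n (real (P n k)) \<le> L'"
    using growth_rate[OF k] by blast
  have sup: "root n (real (P n k)) \<le> L" if "n > 0" for n
    using L'(2)[OF that] LIMSEQ_unique[OF L L'(1)] by simp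
  define D where "D = k - 2"
  define T where "T = (2 :: nat) ^ (D - 1)"
  have D: "D \<ge> 1" "D + 2 = k" "k - 3 = D - 1" using k by (auto simp: D_def)
  have lower: "2 powr (real (D - 1) * real G / (real D * (real G + real D * real T))) \<le> L" for G
  proof -
    define n where "n = D * (G + D * T)"
    have n: "n > 0" using D by (simp add: n_def T_def)
    have "2 ^ ((D - 1) * G) \<le> real (P n k)"
      using P_lower_bound[OF D(1), of G] unfolding D(2) T_def[symmetric] n_def[symmetric]
      by (metis of_nat_le_iff of_nat_numeral of_nat_power)
    then have "root n (2 ^ ((D - 1) * G)) \<le> root n (real (P n k))"
      using n by (intro real_root_le_mono)
    also have "root n (2 ^ ((D - 1) * G)) = 2 powr (real ((D - 1) * G) / real n)"
    proof -
      have "root n (2 ^ ((D - 1) * G)) = (2 powr real ((D - 1) * G)) powr (1 / real n)"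
        using n by (simp add: root_powr_inverse powr_realpow del: of_nat_mult)
      then show ?thesis by (simp only: powr_powr times_divide_eq_right mult_1_right)
    qed
    finally show ?thesis using sup[OF n] by (simp add: n_def)
  qed
  have "(\<lambda>G. real (D - 1) * real G / (real D * (real G + real D * real T)))
      \<longlonglongrightarrow> real (D - 1) / real D"
  proof -
    have "(\<lambda>G. a * real G / (b * (real G + b * c))) \<longlonglongrightarrow> a / b" for a b c :: real
    proof -
      have "(\<lambda>G. real G / (real G + b * c)) \<longlonglongrightarrow> 1" by real_asymp
      from tendsto_mult_left[OF this, of "a / b"] show ?thesis by simp
    qed
    then show ?thesis .
  qed
  then have "(\<lambda>G. 2 powr (real (D - 1) * real G / (real D * (real G + real D * real T))))
      \<longlonglongrightarrow> 2 powr (real (D - 1) / real D)"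
    by (intro tendsto_powr tendsto_const) auto
  then show "2 powr (real (k - 3) / real (k - 2)) \<le> L"
    unfolding D(3) D_def[symmetric] by (rule LIMSEQ_le_const2) (use lower in blast)
qed

theorem mainTheorem5:
  shows "(\<forall>k\<ge>3. convergent (\<lambda>n. root n (real (P n k)))) \<and>
         (\<lambda>k. lim (\<lambda>n. root n (real (P n k)))) \<longlonglongrightarrow> 2"
proof (rule conjI)
  show conv: "\<forall>k\<ge>3. convergent (\<lambda>n. root n (real (P n k)))"
  proof (intro allI impI)
    fix k :: nat assume "k \<ge> 3"
    then obtain L where "(\<lambda>n. root n (real (P n k))) \<longlonglongrightarrow> L"
      using growth_rate by blast
    then show "convergent (\<lambda>n. root n (real (P n k)))" by (rule convergentI)
  qed
  have limit: "(\<lambda>n. root n (real (P n k))) \<longlonglongrightarrow> lim (\<lambda>n. root n (real (P n k)))"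
    if "k \<ge> 3" for k
    using conv that by (simp add: convergent_LIMSEQ_iff)
  have "(\<lambda>k. 2 powr (real (k - 3) / real (k - 2))) \<longlonglongrightarrow> 2" (is "?lower \<longlonglongrightarrow> 2")
  proof (rule Lim_transform_eventually)
    show "(\<lambda>k. 2 powr ((real k - 3) / (real k - 2))) \<longlonglongrightarrow> 2" by real_asymp
    show "\<forall>\<^sub>F k in sequentially. 2 powr ((real k - 3) / (real k - 2)) = ?lower k"
      by (rule eventually_mono[OF eventually_ge_at_top[of 3]]) (simp add: of_nat_diff)
  qed
  moreover have "(\<lambda>k. (2 + 1 / real (k - 1)) * real (k - 1) powr (1 / real (k - 1))) \<longlonglongrightarrow> 2"
    (is "?upper \<longlonglongrightarrow> 2")
  proof (rule Lim_transform_eventually)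
    show "(\<lambda>k. (2 + 1 / (real k - 1)) * (real k - 1) powr (1 / (real k - 1))) \<longlonglongrightarrow> 2" by real_asymp
    show "\<forall>\<^sub>F k in sequentially.
        (2 + 1 / (real k - 1)) * (real k - 1) powr (1 / (real k - 1)) = ?upper k"
      by (rule eventually_mono[OF eventually_ge_at_top[of 3]]) (simp add: of_nat_diff)
  qed
  moreover have "\<forall>\<^sub>F k in sequentially. ?lower k \<le> lim (\<lambda>n. root n (real (P n k)))"
    using growth_rate_bounds(1) limit by (intro eventually_mono[OF eventually_ge_at_top[of 3]]) blast
  moreover have "\<forall>\<^sub>F k in sequentially. lim (\<lambda>n. root n (real (P n k))) \<le> ?upper k"
    using growth_rate_bounds(2) limit by (intro eventually_mono[OF eventually_ge_at_top[of 3]]) blast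
  ultimately show "(\<lambda>k. lim (\<lambda>n. root n (real (P n k)))) \<longlonglongrightarrow> 2"
    by (rule tendsto_sandwich[rotated 2])
qed

end
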